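(* Let $\mathbb{F}$ be a finite field of characteristic $p$, let $n,m,k,\ell$ be positive integers, and let $r=p^\ell$. Then $|\mathcal{P}_{(n,m,k),r}|$ is precisely the number of $k\times n$ matrices over $\mathbb{F}$ of rank at most $m$.
   Context: For positive integers $n,m,k,r$ and a field $\mathbb{F}$, the neuromanifold $\mathcal{P}_{(n,m,k),r}=\mathcal{P}_{(n,m,k),r}(\mathbb{F})$ is the set of all $k$-tuples $(f_1,\dots,f_k)$ of homogeneous polynomials of degree $r$ in $\mathbb{F}[x_1,\dots,x_n]$ of the form $$f_j=\sum_{s=1}^m b_{js}(a_{s1}x_1+\dots+a_{sn}x_n)^r,\qquad j=1,\dots,k,$$ with $(a_{st})\in\mathbb{F}^{m\times n}$ and $(b_{js})\in\mathbb{F}^{k\times m}$ arbitrary. Equality is equality of polynomials, not of functions. *)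

theory Defs
  imports "HOL-Library.Poly_Mapping" "Jordan_Normal_Form.DL_Rank"
begin

text \<open>
  Polynomials in the variables \<open>x\<^sub>0, x\<^sub>1, \<dots>\<close> as finitely supported functions from exponent
  vectors to coefficients; the ring operations (convolution product) are those of
  \<^theory>\<open>HOL-Library.Poly_Mapping\<close>, so equality is equality of coefficients.
  The polynomial ring in \<open>n\<close> variables is the subring involving only
  \<open>x\<^sub>0, \<dots>, x\<^bsub>n-1\<^esub>\<close>.
\<close>

type_synonym 'a mpol = "(nat \<Rightarrow>\<^sub>0 nat) \<Rightarrow>\<^sub>0 'a"

definition mpol_const :: "'a::zero \<Rightarrow> 'a mpol" where
  "mpol_const c = Poly_Mapping.single 0 c"

definition mpol_var :: "nat \<Rightarrow> 'a::zero_neq_one mpol" where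
  "mpol_var t = Poly_Mapping.single (Poly_Mapping.single t 1) 1"

definition linear_form :: "nat \<Rightarrow> 'a::field mat \<Rightarrow> nat \<Rightarrow> 'a mpol" where
  "linear_form n A s = (\<Sum>t<n. mpol_const (A $$ (s, t)) * mpol_var t)"

text \<open>
  Indices start at 0. The \<open>k\<close>-tuples are vectors of dimension \<open>k\<close> with polynomial entries;
  these entries are automatically homogeneous of degree \<open>r\<close> in \<open>x\<^sub>0, \<dots>, x\<^bsub>n-1\<^esub>\<close>.
\<close>

definition neuromanifold :: "nat \<Rightarrow> nat \<Rightarrow> nat \<Rightarrow> nat \<Rightarrow> 'a::field mpol vec set" where
  "neuromanifold n m k r =
     {vec k (\<lambda>j. \<Sum>s<m. mpol_const (B $$ (j, s)) * linear_form n A s ^ r) | A B.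
        A \<in> carrier_mat m n \<and> B \<in> carrier_mat k m}"

end

theory Submission
  imports Defs
begin

text \<open>
  In characteristic \<open>p\<close> the power map with exponent \<open>r = p\<^sup>l\<close> is additive, so the \<open>j\<close>-th entry
  of a point of the neuromanifold is \<open>\<Sum>\<^sub>t (B A\<^sup>[\<^sup>r\<^sup>])\<^sub>j\<^sub>t x\<^sub>t\<^sup>r\<close>, where \<open>A\<^sup>[\<^sup>r\<^sup>]\<close> is the entrywise \<open>r\<close>-th
  power of \<open>A\<close>. Such a tuple is determined by the matrix \<open>B A\<^sup>[\<^sup>r\<^sup>]\<close>. On a finite field the
  power map is bijective, so \<open>A\<^sup>[\<^sup>r\<^sup>]\<close> ranges over all \<open>m \<times> n\<close> matrices, and the products
  of a \<open>k \<times> m\<close> with an \<open>m \<times> n\<close> matrix are exactly the \<open>k \<times> n\<close> matrices of rank at most \<open>m\<close>.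
\<close>

text \<open>The product is a sum of \<open>m\<close> outer products, column of \<open>B\<close>
  times row of \<open>A\<close>. Each has rank at most 1 and rank is subadditive; \<open>P q\<close>
  is the partial sum of the first \<open>q\<close> of them.\<close>

lemma (in vec_space) rank_mult_le:
  assumes B: "B \<in> carrier_mat n m" and A: "A \<in> carrier_mat m nc"
  shows "rank (B * A) \<le> m"
proof -
  define P where "P q = mat n nc (\<lambda>(i, j). \<Sum>s<q. B $$ (i, s) * A $$ (s, j))" for q
  have P: "P q \<in> carrier_mat n nc" for q
    by (simp add: P_def)
  have "rank (P q) \<le> q" for q
  proof (induction q)
    case 0
    have "P 0 = 0\<^sub>m n nc"
      by (auto simp: P_def)
    then show ?case
      by (simp add: rank_0I)
  next
    case (Suc q)
    define R where "R = mat n nc (\<lambda>(i, j). B $$ (i, q) * A $$ (q, j))"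
    have R: "R \<in> carrier_mat n nc"
      by (simp add: R_def)
    have "rank R \<le> 1"
      by (rule rank_le_1_product_entries[OF R, where f = "\<lambda>i. B $$ (i, q)" and g = "\<lambda>j. A $$ (q, j)"])
        (simp add: R_def)
    moreover have "P (Suc q) = P q + R"
      by (auto simp: P_def R_def)
    ultimately show ?case
      using rank_subadditive[OF P R, of q] Suc.IH by simp
  qed
  moreover have "B * A = P m"
    using A B by (auto simp: P_def scalar_prod_def lessThan_atLeast0)
  ultimately show ?thesis
    by simp
qed

text \<open>A vector of \<open>T\<close> outside the span could be added to \<open>S\<close> without
  losing independence, against maximality.\<close>

lemma (in vec_space) maximal_lin_indpt_spans:
  assumes T: "T \<subseteq> carrier_vec n"
    and S: "maximal S (\<lambda>U. U \<subseteq> T \<and> lin_indpt U)"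
  shows "T \<subseteq> span S"
proof
  fix v assume v: "v \<in> T"
  have ST: "S \<subseteq> T" and ind: "lin_indpt S"
    using S by (auto simp: maximal_def)
  have SV: "S \<subseteq> carrier_vec n"
    using ST T by blast
  show "v \<in> span S"
  proof (cases "v \<in> S")
    case True
    then show ?thesis
      using SV by (simp add: span_mem)
  next
    case False
    have "insert v S \<noteq> S"
      using False by blast
    then have "lin_dep (insert v S)"
      using S v ST unfolding maximal_def by (metis insert_subset subset_insertI)
    then show ?thesis
      using lin_dep_iff_in_span[OF _ ind, of v] SV v T False by auto
  qed
qed

text \<open>A maximal independent set \<open>S\<close> of columns of \<open>M\<close> has
  \<open>rank M\<close> elements and spans all columns. Its vectors become columns of
  \<open>B\<close>, and the coordinates of the columns of \<open>M\<close> fill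
  \<open>A\<close>.\<close>

lemma (in vec_space) rank_le_factorization:
  assumes M: "M \<in> carrier_mat n nc" and r: "rank M \<le> m"
  obtains B A where "B \<in> carrier_mat n m" "A \<in> carrier_mat m nc" "M = B * A"
proof -
  let ?ind = "\<lambda>U. U \<subseteq> set (cols M) \<and> lin_indpt U"
  have cols: "set (cols M) \<subseteq> carrier_vec n"
    using cols_dim M by blast
  have "lin_indpt {}"
    unfolding lin_dep_def by blast
  then obtain S where S: "maximal S ?ind" "finite S"
    using maximal_exists_superset[of "set (cols M)" ?ind "{}"] by auto
  have SV: "S \<subseteq> carrier_vec n"
    using S cols by (auto simp: maximal_def)
  have card: "card S \<le> m"
    using rank_card_indpt[OF M S(1)] r by simp
  obtain e where e: "bij_betw e {..<card S} S"
    using ex_bij_betw_nat_finite[OF S(2)] by (auto simp: lessThan_atLeast0)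
  have "\<exists>a. col M j = lincomb a S" if "j < nc" for j
  proof -
    have "col M j \<in> set (cols M)"
      using that M by (auto simp: cols_def)
    then have "col M j \<in> span S"
      using maximal_lin_indpt_spans[OF cols S(1)] by blast
    then show ?thesis
      using finite_span[OF S(2)] SV by auto
  qed
  then obtain a where a: "\<And>j. j < nc \<Longrightarrow> col M j = lincomb (a j) S"
    by metis
  \<comment> \<open>Zero columns pad \<open>B\<close> from \<open>card S\<close> to width
    \<open>m\<close>. They also cancel the rows of \<open>A\<close> with
    \<open>s \<ge> card S\<close>, where \<open>e s\<close> is unspecified.\<close>
  define B where "B = mat n m (\<lambda>(i, s). if s < card S then e s $ i else 0)"
  define A where "A = mat m nc (\<lambda>(s, j). a j (e s))"
  have entry: "M $$ (i, j) = (B * A) $$ (i, j)" if i: "i < n" and j: "j < nc" for i j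
  proof -
    have "M $$ (i, j) = lincomb (a j) S $ i"
      using a[OF j] i j M by (metis carrier_matD index_col)
    also have "\<dots> = (\<Sum>x\<in>S. a j x * x $ i)"
      by (rule lincomb_index[OF i SV])
    also have "\<dots> = (\<Sum>s<card S. a j (e s) * e s $ i)"
      by (rule sum.reindex_bij_betw[OF e, symmetric])
    also have "\<dots> = (\<Sum>s<m. (if s < card S then e s $ i else 0) * a j (e s))"
      using card by (intro sum.mono_neutral_cong_left) auto
    also have "\<dots> = (B * A) $$ (i, j)"
      using i j by (simp add: A_def B_def scalar_prod_def lessThan_atLeast0)
    finally show ?thesis .
  qed
  have AB: "B \<in> carrier_mat n m" "A \<in> carrier_mat m nc"
    by (simp_all add: A_def B_def)
  moreover have "M = B * A"
    by (rule eq_matI) (use M AB entry in auto)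
  ultimately show thesis
    by (rule that)
qed

text \<open>Natural numbers embed as constants, so the coefficient at exponent 0 decides whether one
  vanishes. This makes the Frobenius identity available for polynomials.\<close>

lemma CHAR_poly_mapping:
  "CHAR('b::monoid_add \<Rightarrow>\<^sub>0 'a::semiring_1) = CHAR('a)"
proof (rule CHAR_eqI)
  show "of_nat CHAR('a) = (0 :: 'b \<Rightarrow>\<^sub>0 'a)"
    by (simp flip: single_of_nat)
next
  fix x assume "of_nat x = (0 :: 'b \<Rightarrow>\<^sub>0 'a)"
  then have "Poly_Mapping.lookup (of_nat x :: 'b \<Rightarrow>\<^sub>0 'a) 0 = 0"
    by simp
  then show "CHAR('a) dvd x"
    by (simp add: lookup_of_nat of_nat_eq_0_iff_char_dvd)
qed

lemma bij_power_CHAR_power: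
  assumes "r = CHAR('a::{field,finite}) ^ l"
  shows "bij (\<lambda>x::'a. x ^ r)"
proof -
  have prime: "prime CHAR('a)"
    using prime_CHAR_semidom finite_imp_CHAR_pos by (metis finite)
  have "inj (\<lambda>x::'a. x ^ r)"
  proof (rule injI)
    fix x y :: 'a assume "x ^ r = y ^ r"
    \<comment> \<open>Splitting \<open>x\<close> as \<open>(x - y) + y\<close> forces
      \<open>(x - y) ^ r = 0\<close>, and a field has no nonzero nilpotents.\<close>
    moreover have "x ^ r = (x - y) ^ r + y ^ r"
      using freshmans_dream'[OF prime assms, of "x - y" y] by simp
    ultimately show "x = y"
      by simp
  qed
  then show ?thesis
    by (simp add: bij_def finite_UNIV_inj_surj)
qed

lemma single_sum_right:
  "Poly_Mapping.single u (\<Sum>i\<in>I. f i) = (\<Sum>i\<in>I. Poly_Mapping.single u (f i))"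
  by (induction I rule: infinite_finite_induct) (simp_all add: single_add)

lemma single_single_power:
  "Poly_Mapping.single (Poly_Mapping.single t e) c ^ r =
    Poly_Mapping.single (Poly_Mapping.single t (r * e :: nat)) (c ^ r :: 'a::comm_semiring_1)"
  by (induction r) (simp_all add: mult_single flip: single_add)

text \<open>This is \<open>M\<close> applied to the vector of pure powers \<open>x_t ^ r\<close>.
  Writing the monomials as exponent vectors lets coefficients be read off directly.\<close>

definition diagonal_forms :: "nat \<Rightarrow> nat \<Rightarrow> nat \<Rightarrow> 'a::field mat \<Rightarrow> 'a mpol vec" where
  "diagonal_forms k n r M =
    vec k (\<lambda>j. \<Sum>t<n. Poly_Mapping.single (Poly_Mapping.single t r) (M $$ (j, t)))"

text \<open>The entry at \<open>(j, t)\<close> is the coefficient of \<open>x_t ^ r\<close> in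
  component \<open>j\<close>; for \<open>r > 0\<close> these monomials are pairwise
  distinct.\<close>

lemma inj_on_diagonal_forms:
  assumes "r > 0"
  shows "inj_on (diagonal_forms k n r) (carrier_mat k n)"
proof (rule inj_onI)
  fix M N :: "'a mat"
  assume M: "M \<in> carrier_mat k n" and N: "N \<in> carrier_mat k n"
    and eq: "diagonal_forms k n r M = diagonal_forms k n r N"
  have coeff: "Poly_Mapping.lookup (diagonal_forms k n r L $ j) (Poly_Mapping.single t r) = L $$ (j, t)"
    if "j < k" "t < n" for L :: "'a mat" and j t
  proof -
    have "Poly_Mapping.single s r = Poly_Mapping.single t r \<longleftrightarrow> s = t" for s
      using assms by (metis lookup_single_eq lookup_single_not_eq less_irrefl)
    then show ?thesis
      using that by (simp add: diagonal_forms_def lookup_sum lookup_single when_def)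
  qed
  show "M = N"
  proof (rule eq_matI)
    fix j t assume "j < dim_row N" "t < dim_col N"
    then show "M $$ (j, t) = N $$ (j, t)"
      using coeff[of j t M] coeff[of j t N] eq N by simp
  qed (use M N in auto)
qed

text \<open>The Frobenius identity in the polynomial ring removes all mixed monomials, and each
  coefficient is itself raised to the power \<open>r\<close>.\<close>

lemma linear_form_power_CHAR_power:
  fixes A :: "'a::{field,finite} mat"
  assumes "r = CHAR('a) ^ l"
  shows "linear_form n A s ^ r =
    (\<Sum>t<n. Poly_Mapping.single (Poly_Mapping.single t r) (A $$ (s, t) ^ r))"
proof -
  have "prime CHAR('a)"
    using prime_CHAR_semidom finite_imp_CHAR_pos by (metis finite)
  then have "sum f I ^ r = (\<Sum>t\<in>I. f t ^ r)" for f :: "nat \<Rightarrow> 'a mpol" and I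
    by (intro freshmans_dream_sum') (simp_all add: CHAR_poly_mapping assms)
  then show ?thesis
    by (simp add: linear_form_def mpol_const_def mpol_var_def mult_single single_single_power)
qed

lemma neuromanifold_CHAR_power:
  fixes k m n l r :: nat
  assumes r: "r = CHAR('a::{field,finite}) ^ l"
  shows "(neuromanifold n m k r :: 'a mpol vec set) =
    diagonal_forms k n r ` {B * A | A B. A \<in> carrier_mat m n \<and> B \<in> carrier_mat k m}"
proof -
  have point: "vec k (\<lambda>j. \<Sum>s<m. mpol_const (B $$ (j, s)) * linear_form n A s ^ r) =
      diagonal_forms k n r (B * map_mat (\<lambda>x. x ^ r) A)"
    if A: "A \<in> carrier_mat m n" and B: "B \<in> carrier_mat k m" for A B :: "'a mat"
  proof (rule eq_vecI)
    fix j assume "j < dim_vec (diagonal_forms k n r (B * map_mat (\<lambda>x. x ^ r) A))"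
    then have j: "j < k"
      by (simp add: diagonal_forms_def)
    have "(\<Sum>s<m. mpol_const (B $$ (j, s)) * linear_form n A s ^ r) =
        (\<Sum>s<m. \<Sum>t<n. Poly_Mapping.single (Poly_Mapping.single t r) (B $$ (j, s) * A $$ (s, t) ^ r))"
      by (simp add: linear_form_power_CHAR_power[OF r] mpol_const_def sum_distrib_left mult_single)
    \<comment> \<open>Swapping the sums collects the coefficient of \<open>x_t ^ r\<close>, which is
      an entry of a matrix product.\<close>
    also have "\<dots> = (\<Sum>t<n. Poly_Mapping.single (Poly_Mapping.single t r)
        (\<Sum>s<m. B $$ (j, s) * A $$ (s, t) ^ r))"
      unfolding single_sum_right by (rule sum.swap)
    also have "\<dots> = (\<Sum>t<n. Poly_Mapping.single (Poly_Mapping.single t r)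
        ((B * map_mat (\<lambda>x. x ^ r) A) $$ (j, t)))"
      using A B j by (intro sum.cong refl arg_cong[where f = "Poly_Mapping.single _"])
        (simp add: scalar_prod_def lessThan_atLeast0)
    finally show "vec k (\<lambda>j. \<Sum>s<m. mpol_const (B $$ (j, s)) * linear_form n A s ^ r) $ j =
        diagonal_forms k n r (B * map_mat (\<lambda>x. x ^ r) A) $ j"
      using j by (simp add: diagonal_forms_def)
  qed (simp add: diagonal_forms_def)
  have surj: "\<exists>A' \<in> carrier_mat m n. A = map_mat (\<lambda>x. x ^ r) A'"
    if A: "A \<in> carrier_mat m n" for A :: "'a mat"
  proof
    \<comment> \<open>Entrywise inverse Frobenius supplies the preimage of \<open>A\<close>.\<close>
    define root where "root = inv_into UNIV (\<lambda>x::'a. x ^ r)"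
    have "root x ^ r = x" for x
      using surj_f_inv_f[OF bij_is_surj[OF bij_power_CHAR_power[OF r]]] by (simp add: root_def)
    then show "A = map_mat (\<lambda>x. x ^ r) (map_mat root A)"
      by auto
    show "map_mat root A \<in> carrier_mat m n"
      using A by simp
  qed
  show ?thesis
  proof (intro Set.set_eqI iffI)
    fix f :: "'a mpol vec"
    assume "f \<in> neuromanifold n m k r"
    then obtain A B where AB: "A \<in> carrier_mat m n" "B \<in> carrier_mat k m"
      and f: "f = diagonal_forms k n r (B * map_mat (\<lambda>x. x ^ r) A)"
      unfolding neuromanifold_def using point by blast
    moreover have "map_mat (\<lambda>x. x ^ r) A \<in> carrier_mat m n"
      using AB by simp
    ultimately show "f \<in> diagonal_forms k n r ` {B * A | A B. A \<in> carrier_mat m n \<and> B \<in> carrier_mat k m}"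
      by blast
  next
    fix f :: "'a mpol vec"
    assume "f \<in> diagonal_forms k n r ` {B * A | A B. A \<in> carrier_mat m n \<and> B \<in> carrier_mat k m}"
    then obtain A B where "A \<in> carrier_mat m n" "B \<in> carrier_mat k m" "f = diagonal_forms k n r (B * A)"
      by blast
    moreover obtain A' where "A' \<in> carrier_mat m n" "A = map_mat (\<lambda>x. x ^ r) A'"
      using surj[OF calculation(1)] by blast
    ultimately show "f \<in> neuromanifold n m k r"
      unfolding neuromanifold_def using point[of A' B, symmetric] by blast
  qed
qed

theorem proposition5p2:
  fixes n m k l p r :: nat
  assumes "CHAR('a::{field,finite}) = p"
    and "n > 0" and "m > 0" and "k > 0" and "l > 0"
    and "r = p ^ l"
  shows "card (neuromanifold n m k r :: 'a mpol vec set) =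
         card {M :: 'a mat. M \<in> carrier_mat k n \<and> vec_space.rank k M \<le> m}"
proof -
  let ?R = "{M :: 'a mat. M \<in> carrier_mat k n \<and> vec_space.rank k M \<le> m}"
  have r: "r = CHAR('a) ^ l"
    using assms by simp
  \<comment> \<open>A finite field has positive characteristic; positivity of \<open>r\<close> is
    what injectivity of \<open>diagonal_forms\<close> requires.\<close>
  have "r > 0"
    using finite_imp_CHAR_pos[where ?'a = 'a] by (simp add: r)
  \<comment> \<open>Factorization gives one inclusion between products and matrices of bounded rank;
    the rank bound for products gives the other.\<close>
  have "\<exists>A B. M = B * A \<and> A \<in> carrier_mat m n \<and> B \<in> carrier_mat k m" if "M \<in> ?R" for M
    using that vec_space.rank_le_factorization[of M k n m] by blast
  then have "{B * A | A B. A \<in> carrier_mat m n \<and> B \<in> carrier_mat k m} = ?R"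
    by (auto intro: vec_space.rank_mult_le)
  then have "neuromanifold n m k r = diagonal_forms k n r ` ?R"
    by (simp add: neuromanifold_CHAR_power[OF r])
  moreover have "inj_on (diagonal_forms k n r) ?R"
    by (rule inj_on_subset[OF inj_on_diagonal_forms[OF \<open>r > 0\<close>]]) blast
  ultimately show ?thesis
    by (simp add: card_image)
qed

end
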